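(* Let $G$ be a locally compact, compactly generated group, let $\pi$ be a strongly continuous representation of $G$ on a Banach space $E$, and let $\mu$ be a symmetric probability measure on $G$, given by a continuous compactly supported density with respect to Haar measure and whose support generates $G$, such that $\Vert A_\pi^\mu\Vert<1$. Then the following conditions are equivalent: (1) $H^1(G,\pi)=0$; (2) $b(\gamma\cdot z)=b(z)$ for every $z\in Z^1(G,\pi)$ and every $\gamma\in G$, where $(\gamma\cdot z)_g=z_{\gamma g}$ for $g\in G$.
   Context: A strongly continuous representation is a homomorphism $g\mapsto\pi_g$ from $G$ to the invertible bounded linear operators on $E$ such that $g\mapsto\pi_g v$ is continuous for each $v\in E$. Integrals are Bochner integrals. The Markov operator is $A_\pi^\mu v=\int_G\pi_g v\,d\mu(g)$. $Z^1(G,\pi)$ is the space of continuous maps $z:G\to E$, $g\mapsto z_g$, with $z_{gh}=\pi_g z_h+z_g$ for all $g,h\in G$; $B^1(G,\pi)\subseteq Z^1(G,\pi)$ is the subspace of coboundaries $g\mapsto v-\pi_g v$, $v\in E$; $H^1(G,\pi)=Z^1(G,\pi)/B^1(G,\pi)$. For a continuous map $f:G\to E$ and a compactly supported probability measure $\nu$ on $G$ put $f^{\nu}=\int_G f_g\,d\nu(g)$. Let $\mu^n$ be the $n$-th convolution power of $\mu$. Define $b(f)=\lim_{n\to\infty}f^{(\mu^n)}$ whenever this limit exists in norm. When $\Vert A_\pi^\mu\Vert<1$ this limit exists for every $z\in Z^1(G,\pi)$, where $b(z)$ is the unique fixed point in $E$ of the affine map $v\mapsto A_\pi^\mu v+z^{\mu}$,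 and also for every translate $\gamma\cdot z$ (which need not itself be a cocycle). *)

theory Defs
  imports "HOL-Probability.Probability"
begin

text \<open>
  Groups are written additively, because the topological groups of the library
  (class \<^class>\<open>topological_group_add\<close>) are; the class does not assume commutativity.
  So \<open>g + h\<close> stands for the product \<open>gh\<close>, \<open>- g\<close> for the inverse and \<open>0\<close> for the identity.
  Banach spaces are real; a complex Banach space is covered through its
  underlying real one, which has the same norm, operator norms and cocycles.
\<close>

subsection \<open>Generation\<close>

definition is_subgroup :: "'g::group_add set \<Rightarrow> bool" where
  "is_subgroup H \<longleftrightarrow> 0 \<in> H \<and> (\<forall>x\<in>H. \<forall>y\<in>H. x + y \<in> H) \<and> (\<forall>x\<in>H. - x \<in> H)"

definition generates :: "'g::group_add set \<Rightarrow> bool" where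
  "generates S \<longleftrightarrow> is_subgroup hull S = UNIV"

subsection \<open>Measures\<close>

definition left_haar_measure :: "'g::topological_group_add measure \<Rightarrow> bool" where
  "left_haar_measure M \<longleftrightarrow>
     sets M = sets borel \<and>
     emeasure M UNIV \<noteq> 0 \<and>
     (\<forall>a. distr M borel (\<lambda>x. a + x) = M) \<and>
     (\<forall>K. compact K \<longrightarrow> emeasure M K < \<infinity>) \<and>
     (\<forall>A\<in>sets borel. emeasure M A = (INF U\<in>{U. open U \<and> A \<subseteq> U}. emeasure M U)) \<and>
     (\<forall>U. open U \<longrightarrow> emeasure M U = (SUP K\<in>{K. compact K \<and> K \<subseteq> U}. emeasure M K))"

text \<open>
  Left and right Haar measures differ by a continuous positive factor, so the next
  notion does not depend on the choice of the left one.
\<close>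

definition has_continuous_compact_density :: "'g::topological_group_add measure \<Rightarrow> bool" where
  "has_continuous_compact_density \<mu> \<longleftrightarrow>
     (\<exists>M \<rho>. left_haar_measure M \<and> continuous_on UNIV \<rho> \<and> (\<forall>x. 0 \<le> \<rho> x) \<and>
        compact (closure {x. \<rho> x \<noteq> (0::real)}) \<and> \<mu> = density M (\<lambda>x. ennreal (\<rho> x)))"

definition symmetric_measure :: "'g::topological_group_add measure \<Rightarrow> bool" where
  "symmetric_measure \<mu> \<longleftrightarrow> distr \<mu> borel uminus = \<mu>"

definition measure_support :: "'g::topological_space measure \<Rightarrow> 'g set" where
  "measure_support \<mu> = {x. \<forall>U. open U \<and> x \<in> U \<longrightarrow> 0 < emeasure \<mu> U}"

text \<open>
  Convolution is given by the formula \<open>(\<mu> * \<nu>)(A) = \<integral> \<nu>(x\<^sup>-\<^sup>1A) d\<mu>(x)\<close> and not as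
  an image of the product measure: if the group is not second countable, the group
  operation need not be measurable for the product of the Borel \<open>\<sigma>\<close>-algebras.
\<close>

definition group_convolution ::
    "'g::topological_group_add measure \<Rightarrow> 'g measure \<Rightarrow> 'g measure" where
  "group_convolution \<mu> \<nu> =
     measure_of UNIV (sets borel) (\<lambda>A. \<integral>\<^sup>+x. emeasure \<nu> ((\<lambda>y. x + y) -` A) \<partial>\<mu>)"

primrec convolution_power ::
    "'g::topological_group_add measure \<Rightarrow> nat \<Rightarrow> 'g measure" where
  "convolution_power \<mu> 0 = return borel 0"
| "convolution_power \<mu> (Suc n) = group_convolution (convolution_power \<mu> n) \<mu>"

subsection \<open>Bochner integral\<close>

text \<open>
  The same definitions as \<^const>\<open>has_bochner_integral\<close> and \<^const>\<open>lebesgue_integral\<close>, which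
  the library only provides for separable target spaces.
\<close>

definition has_bochner_int :: "'a measure \<Rightarrow> ('a \<Rightarrow> 'e::real_normed_vector) \<Rightarrow> 'e \<Rightarrow> bool" where
  "has_bochner_int M f v \<longleftrightarrow> f \<in> borel_measurable M \<and>
     (\<exists>s. (\<forall>i::nat. Bochner_Integration.simple_bochner_integrable M (s i)) \<and>
        (\<lambda>i. \<integral>\<^sup>+x. ennreal (norm (f x - s i x)) \<partial>M) \<longlonglongrightarrow> 0 \<and>
        (\<lambda>i. Bochner_Integration.simple_bochner_integral M (s i)) \<longlonglongrightarrow> v)"

definition bochner_int :: "'a measure \<Rightarrow> ('a \<Rightarrow> 'e::real_normed_vector) \<Rightarrow> 'e" where
  "bochner_int M f =
     (if \<exists>v. has_bochner_int M f v then THE v. has_bochner_int M f v else 0)"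

subsection \<open>Representations and cohomology\<close>

definition strongly_continuous_representation ::
    "('g::topological_group_add \<Rightarrow> 'e::banach \<Rightarrow>\<^sub>L 'e) \<Rightarrow> bool" where
  "strongly_continuous_representation \<pi> \<longleftrightarrow>
     (\<forall>g h. \<pi> (g + h) = \<pi> g o\<^sub>L \<pi> h) \<and>
     (\<forall>g. \<exists>T. \<pi> g o\<^sub>L T = id_blinfun \<and> T o\<^sub>L \<pi> g = id_blinfun) \<and>
     (\<forall>v. continuous_on UNIV (\<lambda>g. blinfun_apply (\<pi> g) v))"

definition markov_operator ::
    "('g::topological_group_add \<Rightarrow> 'e::banach \<Rightarrow>\<^sub>L 'e) \<Rightarrow> 'g measure \<Rightarrow> 'e \<Rightarrow> 'e" where
  "markov_operator \<pi> \<mu> v = bochner_int \<mu> (\<lambda>g. blinfun_apply (\<pi> g) v)"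

definition Z1 :: "('g::topological_group_add \<Rightarrow> 'e::banach \<Rightarrow>\<^sub>L 'e) \<Rightarrow> ('g \<Rightarrow> 'e) set" where
  "Z1 \<pi> = {z. continuous_on UNIV z \<and> (\<forall>g h. z (g + h) = blinfun_apply (\<pi> g) (z h) + z g)}"

definition B1 :: "('g::topological_group_add \<Rightarrow> 'e::banach \<Rightarrow>\<^sub>L 'e) \<Rightarrow> ('g \<Rightarrow> 'e) set" where
  "B1 \<pi> = range (\<lambda>v g. v - blinfun_apply (\<pi> g) v)"

definition cohomologous ::
    "('g::topological_group_add \<Rightarrow> 'e::banach \<Rightarrow>\<^sub>L 'e) \<Rightarrow> (('g \<Rightarrow> 'e) \<times> ('g \<Rightarrow> 'e)) set" where
  "cohomologous \<pi> = {(z, w). z \<in> Z1 \<pi> \<and> w \<in> Z1 \<pi> \<and> (\<lambda>g. z g - w g) \<in> B1 \<pi>}"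

text \<open>The zero vector of the quotient space \<open>H1 \<pi>\<close> is the class \<open>B1 \<pi>\<close>.\<close>

definition H1 :: "('g::topological_group_add \<Rightarrow> 'e::banach \<Rightarrow>\<^sub>L 'e) \<Rightarrow> ('g \<Rightarrow> 'e) set set" where
  "H1 \<pi> = Z1 \<pi> // cohomologous \<pi>"

subsection \<open>Barycentres and translates\<close>

definition barycentre :: "'g::topological_group_add measure \<Rightarrow> ('g \<Rightarrow> 'e::banach) \<Rightarrow> 'e" where
  "barycentre \<mu> f = lim (\<lambda>n. bochner_int (convolution_power \<mu> n) f)"

definition translate :: "'g::group_add \<Rightarrow> ('g \<Rightarrow> 'e) \<Rightarrow> 'g \<Rightarrow> 'e" where
  "translate \<gamma> z = (\<lambda>g. z (\<gamma> + g))"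

end

theory Submission
  imports Defs
begin

text \<open>
  For a cocycle, the translate by \<open>\<gamma>\<close> is the image of \<open>z\<close> under the affine map
  \<open>v \<mapsto> \<pi> \<gamma> v + z \<gamma>\<close>. Integrating against \<open>\<mu>\<^sup>n\<close> and letting \<open>n\<close> tend to infinity shows that the
  barycentre of the translate is \<open>\<pi> \<gamma> b + z \<gamma>\<close>, where \<open>b\<close> is the barycentre of \<open>z\<close>. So invariance
  says precisely that \<open>z\<close> is the coboundary of \<open>b\<close>. The barycentre exists because the integrals of
  \<open>z\<close> against \<open>\<mu>\<^sup>n\<close> are the partial sums of the Neumann series of the Markov operator, which is
  bounded by the uniform boundedness principle.
\<close>

subsection \<open>Uniform boundedness\<close>

text \<open>By Baire, one of the closed sets \<open>F n\<close>, on which the family is bounded by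
  \<open>n\<close>, contains a ball; linearity turns the bound on a ball into a bound on operator
  norms.\<close>

lemma uniform_boundedness_principle:
  fixes T :: "'i \<Rightarrow> 'e::banach \<Rightarrow>\<^sub>L 'f::real_normed_vector"
  assumes "\<And>v. \<exists>C. \<forall>i\<in>I. norm (T i v) \<le> C"
  shows "\<exists>C. \<forall>i\<in>I. norm (T i) \<le> C"
proof -
  define F where "F n = {v. \<forall>i\<in>I. norm (T i v) \<le> real n}" for n
  have closed: "closed (F n)" for n
  proof -
    have "F n = (\<Inter>i\<in>I. {v. norm (T i v) \<le> real n})"
      by (auto simp: F_def)
    moreover have "closed {v. norm (T i v) \<le> real n}" for i
      by (intro closed_Collect_le continuous_intros)
    ultimately show ?thesis by auto
  qed
  have cover: "(\<Union>n. F n) = UNIV"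
  proof -
    have "\<exists>n. v \<in> F n" for v
    proof -
      obtain C where C: "\<forall>i\<in>I. norm (T i v) \<le> C" using assms by blast
      obtain n where "C \<le> real n" using real_arch_simple by blast
      with C have "v \<in> F n" unfolding F_def by fastforce
      then show ?thesis ..
    qed
    then show ?thesis by auto
  qed
  have "Met_TC.mcomplete TYPE('e)"
    by (simp add: complete_UNIV)
  \<comment> \<open>A countable union of closed sets with empty interior has empty interior, whereas
    here the union is the whole space.\<close>
  then have "\<exists>n. interior (F n) \<noteq> {}"
    using Met_TC.metric_Baire_category_alt[of "range F"] closed cover by auto
  then obtain n a r where r: "r > 0" "ball a r \<subseteq> F n"
    by (metis ex_in_conv mem_interior)
  have "norm (T i) \<le> 4 * real n / r" if i: "i \<in> I" for i
  proof (rule norm_blinfun_bound)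
    show "0 \<le> 4 * real n / r" using r by simp
    fix v
    show "norm (T i v) \<le> 4 * real n / r * norm v"
    proof (cases "v = 0")
      case False
      \<comment> \<open>The factor gives \<open>w\<close> norm \<open>r / 2\<close>, so
        \<open>a + w\<close> stays in the ball. The bounds at \<open>a + w\<close> and
        \<open>a\<close> give \<open>2 * n\<close> for \<open>T i w\<close>, and undoing the scaling
        gives \<open>4 * n / r\<close>.\<close>
      define w where "w = (r / (2 * norm v)) *\<^sub>R v"
      have "norm w < r" using False r by (simp add: w_def)
      then have "a + w \<in> F n" "a \<in> F n" using r by (auto simp: subset_iff dist_norm)
      then have b: "norm (T i (a + w)) \<le> n" "norm (T i a) \<le> n" using i by (auto simp: F_def)
      have "T i w = T i (a + w) - T i a" by (simp add: blinfun.add_right)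
      then have "norm (T i w) \<le> 2 * n"
        using b norm_triangle_ineq4[of "T i (a + w)" "T i a"] by simp
      moreover have "norm (T i w) = r / (2 * norm v) * norm (T i v)"
        using r by (simp add: w_def blinfun.scaleR_right)
      ultimately show ?thesis using r False by (simp add: field_simps)
    qed simp
  qed
  then show ?thesis by blast
qed

subsection \<open>The Bochner integral in non-separable spaces\<close>

abbreviation simple_integrable :: "'a measure \<Rightarrow> ('a \<Rightarrow> 'e::real_vector) \<Rightarrow> bool" where
  "simple_integrable \<equiv> Bochner_Integration.simple_bochner_integrable"

abbreviation simple_integral :: "'a measure \<Rightarrow> ('a \<Rightarrow> 'e::real_vector) \<Rightarrow> 'e" where
  "simple_integral \<equiv> Bochner_Integration.simple_bochner_integral"

lemma tendsto_0_le_ennreal: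
  fixes a b :: "nat \<Rightarrow> ennreal"
  assumes "b \<longlonglongrightarrow> 0" "\<And>i. a i \<le> b i"
  shows "a \<longlonglongrightarrow> 0"
  using assms by (auto intro: tendsto_sandwich[OF _ _ tendsto_const assms(1)])

text \<open>A difference of Borel maps into a nonseparable space can fail to be Borel. Since
  \<open>s\<close> has finite image, this one is glued from the maps \<open>f x - y\<close> with
  \<open>y\<close> fixed.\<close>

lemma borel_measurable_diff_simple_function:
  fixes f s :: "'a \<Rightarrow> 'e::real_normed_vector"
  assumes "f \<in> borel_measurable M" "simple_function M s"
  shows "(\<lambda>x. f x - s x) \<in> borel_measurable M"
proof (rule measurable_compose_countable'[where f = "\<lambda>y x. f x - y" and g = s and I = "s ` space M"])
  show "(\<lambda>x. f x - y) \<in> borel_measurable M" for y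
    using measurable_compose[OF assms(1) borel_measurable_continuous_onI[of "\<lambda>v. v - y"]]
    by (simp add: continuous_intros)
  show "s \<in> measurable M (count_space (s ` space M))"
    using assms(2) by (simp add: simple_function_def measurable_count_space_eq2)
  show "countable (s ` space M)"
    using assms(2) by (simp add: simple_function_def countable_finite)
qed

lemma borel_measurable_norm_diff_simple:
  fixes f s :: "'a \<Rightarrow> 'e::real_normed_vector"
  assumes "f \<in> borel_measurable M" "simple_integrable M s"
  shows "(\<lambda>x. norm (f x - s x)) \<in> borel_measurable M"
  using measurable_compose[OF borel_measurable_diff_simple_function
      borel_measurable_continuous_onI[of norm]] assms
  by (auto simp: simple_bochner_integrable.simps continuous_intros)

text \<open>Triangle inequality through \<open>f\<close>, integrated. Comparing two approximations
  of the same \<open>f\<close> serves both uniqueness and existence of the integral.\<close>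

lemma norm_simple_bochner_integral_diff_le:
  fixes f :: "'a \<Rightarrow> 'e::real_normed_vector"
  assumes f: "f \<in> borel_measurable M"
  assumes s: "simple_integrable M s" and t: "simple_integrable M t"
  shows "ennreal (norm (simple_integral M s - simple_integral M t)) \<le>
    (\<integral>\<^sup>+x. norm (f x - s x) \<partial>M) + (\<integral>\<^sup>+x. norm (f x - t x) \<partial>M)"
proof -
  note [measurable] = borel_measurable_norm_diff_simple[OF f s] borel_measurable_norm_diff_simple[OF f t]
  have "ennreal (norm (simple_integral M s - simple_integral M t)) =
      norm (simple_integral M (\<lambda>x. s x - t x))"
    using s t by (subst simple_bochner_integral_diff) auto
  also have "\<dots> \<le> simple_integral M (\<lambda>x. norm (s x - t x))"
    using simple_bochner_integrable_compose2[of "(-)" M s t] s t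
    by (auto intro!: simple_bochner_integral_norm_bound)
  also have "\<dots> = (\<integral>\<^sup>+x. norm (s x - t x) \<partial>M)"
    using simple_bochner_integrable_compose2[of "\<lambda>x y. norm (x - y)" M s t] s t
    by (auto intro!: simple_bochner_integral_eq_nn_integral)
  also have "\<dots> \<le> (\<integral>\<^sup>+x. ennreal (norm (f x - s x)) + ennreal (norm (f x - t x)) \<partial>M)"
    by (intro nn_integral_mono)
       (metis ennreal_leI ennreal_plus norm_ge_zero norm_minus_commute norm_diff_triangle_le order_refl)
  also have "\<dots> = (\<integral>\<^sup>+x. norm (f x - s x) \<partial>M) + (\<integral>\<^sup>+x. norm (f x - t x) \<partial>M)"
    by (rule nn_integral_add) auto
  finally show ?thesis .
qed

text \<open>Pass to the limit along a sequence \<open>t\<close> defining \<open>v\<close>: its own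
  error term vanishes. Later comparisons of integrals rest on this error estimate.\<close>

lemma norm_has_bochner_int_diff_simple_le:
  assumes "has_bochner_int M f v" and s: "simple_integrable M s"
  shows "ennreal (norm (v - simple_integral M s)) \<le> (\<integral>\<^sup>+x. norm (f x - s x) \<partial>M)"
proof -
  obtain t where f: "f \<in> borel_measurable M"
    and t: "\<And>i::nat. simple_integrable M (t i)"
    and lim: "(\<lambda>i. \<integral>\<^sup>+x. ennreal (norm (f x - t i x)) \<partial>M) \<longlonglongrightarrow> 0"
      "(\<lambda>i. simple_integral M (t i)) \<longlonglongrightarrow> v"
    using assms(1) by (auto simp: has_bochner_int_def)
  have "(\<lambda>i. ennreal (norm (simple_integral M (t i) - simple_integral M s)))
      \<longlonglongrightarrow> ennreal (norm (v - simple_integral M s))"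
    by (intro tendsto_intros lim tendsto_ennrealI)
  moreover have "(\<lambda>i. (\<integral>\<^sup>+x. norm (f x - t i x) \<partial>M) + (\<integral>\<^sup>+x. norm (f x - s x) \<partial>M))
      \<longlonglongrightarrow> 0 + (\<integral>\<^sup>+x. norm (f x - s x) \<partial>M)"
    by (intro tendsto_intros lim)
  ultimately show ?thesis
    using norm_simple_bochner_integral_diff_le[OF f t s] by (auto intro: LIMSEQ_le)
qed

lemma has_bochner_int_unique:
  assumes "has_bochner_int M f v" "has_bochner_int M f w"
  shows "v = w"
proof -
  obtain s where s: "\<And>i::nat. simple_integrable M (s i)"
    and lim: "(\<lambda>i. \<integral>\<^sup>+x. ennreal (norm (f x - s i x)) \<partial>M) \<longlonglongrightarrow> 0"
      "(\<lambda>i. simple_integral M (s i)) \<longlonglongrightarrow> w"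
    using assms(2) by (auto simp: has_bochner_int_def)
  have "(\<lambda>i. ennreal (norm (v - simple_integral M (s i)))) \<longlonglongrightarrow> ennreal (norm (v - w))"
    by (intro tendsto_intros lim tendsto_ennrealI)
  then have "ennreal (norm (v - w)) \<le> 0"
    using LIMSEQ_le[OF _ lim(1)] norm_has_bochner_int_diff_simple_le[OF assms(1) s] by blast
  then show ?thesis by simp
qed

lemma bochner_int_eq: "has_bochner_int M f v \<Longrightarrow> bochner_int M f = v"
  unfolding bochner_int_def by (auto intro: the_equality has_bochner_int_unique)

lemma norm_has_bochner_int_le:
  assumes "has_bochner_int M f v"
  shows "ennreal (norm v) \<le> (\<integral>\<^sup>+x. norm (f x) \<partial>M)"
proof -
  \<comment> \<open>The zero function as approximant turns the error estimate into the norm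
    inequality.\<close>
  have "simple_integrable M (\<lambda>_. 0 :: 'b)"
    by (intro simple_bochner_integrable.intros) auto
  from norm_has_bochner_int_diff_simple_le[OF assms this]
  show ?thesis by (simp add: simple_bochner_integral_def image_constant_conv split: if_splits)
qed

lemma norm_has_bochner_int_le_bound:
  assumes "prob_space M" "has_bochner_int M f v" "AE x in M. norm (f x) \<le> c" "0 \<le> c"
  shows "norm v \<le> c"
proof -
  interpret prob_space M by fact
  note norm_has_bochner_int_le[OF assms(2)]
  also have "(\<integral>\<^sup>+x. norm (f x) \<partial>M) \<le> (\<integral>\<^sup>+x. c \<partial>M)"
    using assms(3) by (intro nn_integral_mono_AE) (auto intro: ennreal_leI)
  also have "\<dots> = c" by (simp add: emeasure_space_1)
  finally show ?thesis using assms(4) by simp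
qed

text \<open>Measurability of the sum is not automatic when the target space is not separable.\<close>
lemma has_bochner_int_add:
  assumes f: "has_bochner_int M f v" and g: "has_bochner_int M g w"
    and fg: "(\<lambda>x. f x + g x) \<in> borel_measurable M"
  shows "has_bochner_int M (\<lambda>x. f x + g x) (v + w)"
proof -
  obtain s where fm: "f \<in> borel_measurable M" and s: "\<And>i::nat. simple_integrable M (s i)"
    and ls: "(\<lambda>i. \<integral>\<^sup>+x. ennreal (norm (f x - s i x)) \<partial>M) \<longlonglongrightarrow> 0"
      "(\<lambda>i. simple_integral M (s i)) \<longlonglongrightarrow> v"
    using f by (auto simp: has_bochner_int_def)
  obtain t where gm: "g \<in> borel_measurable M" and t: "\<And>i::nat. simple_integrable M (t i)"
    and lt: "(\<lambda>i. \<integral>\<^sup>+x. ennreal (norm (g x - t i x)) \<partial>M) \<longlonglongrightarrow> 0"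
      "(\<lambda>i. simple_integral M (t i)) \<longlonglongrightarrow> w"
    using g by (auto simp: has_bochner_int_def)
  note [measurable] = borel_measurable_norm_diff_simple[OF fm s] borel_measurable_norm_diff_simple[OF gm t]
  have st: "simple_integrable M (\<lambda>x. s i x + t i x)" for i
    using simple_bochner_integrable_compose2[of "(+)", OF _ s t] by simp
  have le: "(\<integral>\<^sup>+x. norm (f x + g x - (s i x + t i x)) \<partial>M)
      \<le> (\<integral>\<^sup>+x. norm (f x - s i x) \<partial>M) + (\<integral>\<^sup>+x. norm (g x - t i x) \<partial>M)" for i
  proof -
    have "(\<integral>\<^sup>+x. norm (f x + g x - (s i x + t i x)) \<partial>M)
        \<le> (\<integral>\<^sup>+x. ennreal (norm (f x - s i x)) + ennreal (norm (g x - t i x)) \<partial>M)"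
    proof (intro nn_integral_mono)
      fix x
      have "norm (f x + g x - (s i x + t i x)) \<le> norm (f x - s i x) + norm (g x - t i x)"
        by (metis add_diff_add norm_triangle_ineq)
      then show "ennreal (norm (f x + g x - (s i x + t i x))) \<le> ennreal (norm (f x - s i x)) + ennreal (norm (g x - t i x))"
        by (metis ennreal_leI ennreal_plus norm_ge_zero)
    qed
    also have "\<dots> = (\<integral>\<^sup>+x. norm (f x - s i x) \<partial>M) + (\<integral>\<^sup>+x. norm (g x - t i x) \<partial>M)"
      by (rule nn_integral_add) auto
    finally show ?thesis .
  qed
  have "(\<lambda>i. \<integral>\<^sup>+x. norm (f x + g x - (s i x + t i x)) \<partial>M) \<longlonglongrightarrow> 0"
    using tendsto_add[OF ls(1) lt(1)] le
    by (intro tendsto_0_le_ennreal[OF _ le]) auto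
  moreover have "(\<lambda>i. simple_integral M (\<lambda>x. s i x + t i x)) \<longlonglongrightarrow> v + w"
    using tendsto_add[OF ls(2) lt(2)] s t by (simp add: simple_bochner_integral_add)
  ultimately show ?thesis
    unfolding has_bochner_int_def
    by (intro conjI fg exI[of _ "\<lambda>i x. s i x + t i x"] allI st)
qed

text \<open>Applying \<open>T\<close> to the approximating simple functions multiplies the errors by
  at most a bound \<open>K\<close> for \<open>T\<close>; continuity of \<open>T\<close> keeps the
  composite measurable.\<close>

lemma has_bochner_int_bounded_linear:
  assumes T: "bounded_linear T" and f: "has_bochner_int M f v"
  shows "has_bochner_int M (\<lambda>x. T (f x)) (T v)"
proof -
  interpret T: bounded_linear T by fact
  obtain K where K: "0 \<le> K" "\<And>x. norm (T x) \<le> norm x * K" using T.nonneg_bounded by auto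
  obtain s where fm: "f \<in> borel_measurable M" and s: "\<And>i::nat. simple_integrable M (s i)"
    and ls: "(\<lambda>i. \<integral>\<^sup>+x. ennreal (norm (f x - s i x)) \<partial>M) \<longlonglongrightarrow> 0"
      "(\<lambda>i. simple_integral M (s i)) \<longlonglongrightarrow> v"
    using f by (auto simp: has_bochner_int_def)
  note [measurable] = borel_measurable_norm_diff_simple[OF fm s]
  have le: "(\<integral>\<^sup>+x. norm (T (f x) - T (s i x)) \<partial>M) \<le> ennreal K * (\<integral>\<^sup>+x. norm (f x - s i x) \<partial>M)" for i
  proof -
    have "(\<integral>\<^sup>+x. norm (T (f x) - T (s i x)) \<partial>M) \<le> (\<integral>\<^sup>+x. ennreal K * norm (f x - s i x) \<partial>M)"
      using K by (intro nn_integral_mono)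
        (simp add: T.diff[symmetric] ennreal_mult[symmetric] ennreal_leI mult.commute)
    also have "\<dots> = ennreal K * (\<integral>\<^sup>+x. norm (f x - s i x) \<partial>M)"
      by (rule nn_integral_cmult) auto
    finally show ?thesis .
  qed
  have "(\<lambda>i. ennreal K * (\<integral>\<^sup>+x. norm (f x - s i x) \<partial>M)) \<longlonglongrightarrow> ennreal K * 0"
    by (intro ennreal_tendsto_cmult ls) auto
  then have "(\<lambda>i. \<integral>\<^sup>+x. norm (T (f x) - T (s i x)) \<partial>M) \<longlonglongrightarrow> 0"
    using le by (intro tendsto_0_le_ennreal[OF _ le]) auto
  moreover have "(\<lambda>i. simple_integral M (\<lambda>x. T (s i x))) \<longlonglongrightarrow> T v"
    using T.tendsto[OF ls(2)] s T.linear_axioms by (simp add: simple_bochner_integral_linear)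
  moreover have "simple_integrable M (\<lambda>x. T (s i x))" for i
    using simple_bochner_integrable_compose2[of "\<lambda>x y. T x", OF _ s s] T.zero by simp
  moreover have "(\<lambda>x. T (f x)) \<in> borel_measurable M"
    using measurable_compose[OF fm borel_measurable_continuous_onI[of T]] T.continuous_on
      continuous_on_id by blast
  ultimately show ?thesis
    unfolding has_bochner_int_def by (intro conjI exI[of _ "\<lambda>i x. T (s i x)"] allI)
qed

lemma has_bochner_integral_imp_has_bochner_int:
  "has_bochner_integral M f v \<Longrightarrow> has_bochner_int M f v"
  by (auto simp: has_bochner_integral.simps has_bochner_int_def)

text \<open>Transferred from the real constant 1, whose integral is the total mass, along the linear
  map that multiplies \<open>c\<close> by a scalar.\<close>

lemma has_bochner_int_const:
  assumes "prob_space M"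
  shows "has_bochner_int M (\<lambda>_. c) c"
proof -
  interpret prob_space M by fact
  have "has_bochner_int M (\<lambda>_. 1 :: real) 1"
    by (rule has_bochner_integral_imp_has_bochner_int)
       (simp add: has_bochner_integral_iff prob_space)
  from has_bochner_int_bounded_linear[OF bounded_linear_scaleR_left[of c] this] show ?thesis by simp
qed

section \<open>Integrating continuous functions against compactly supported measures\<close>

text \<open>Any compact set of full measure will do as \<open>K\<close>, not just the topological
  support; this form feeds directly into almost-everywhere estimates.\<close>

definition compactly_supported :: "'g::topological_space measure \<Rightarrow> bool" where
  "compactly_supported M \<longleftrightarrow> prob_space M \<and> sets M = sets borel \<and> (\<exists>K. compact K \<and> (AE x in M. x \<in> K))"

text \<open>The image of \<open>K\<close> is compact, hence totally bounded, so rounding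
  \<open>f\<close> to the centres of a finite net gives a uniform approximation on \<open>K\<close>
  even if \<open>E\<close> is not separable.\<close>

lemma simple_approximation_on_compact:
  fixes f :: "'g::topological_space \<Rightarrow> 'e::real_normed_vector"
  assumes "prob_space M" "sets M = sets borel" "continuous_on UNIV f" "compact K" "e > 0"
  shows "\<exists>s. simple_integrable M s \<and> (\<forall>x\<in>K. norm (f x - s x) < e)"
proof -
  interpret prob_space M by fact
  have space: "space M = UNIV" using sets_eq_imp_space_eq[OF assms(2)] by simp
  \<comment> \<open>Induction over the net: a new centre overrides the old choice on the open set
    where it is close enough, so the rounded function stays measurable.\<close>
  have "\<exists>s. simple_function M s \<and> (\<forall>x. (\<exists>y\<in>Y. norm (f x - y) < e) \<longrightarrow> norm (f x - s x) < e)"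
    if "finite Y" for Y
    using that
  proof induction
    case empty
    show ?case by (intro exI[of _ "\<lambda>_. 0"]) simp
  next
    case (insert y Y)
    then obtain s where s: "simple_function M s"
      "\<forall>x. (\<exists>y\<in>Y. norm (f x - y) < e) \<longrightarrow> norm (f x - s x) < e" by blast
    have "open {x. norm (f x - y) < e}"
      by (intro open_Collect_less continuous_intros assms(3))
    then have "simple_function M (\<lambda>x. if norm (f x - y) < e then y else s x)"
      using s by (intro simple_function_If) (auto simp: space assms(2))
    then show ?case using s(2)
      by (intro exI[of _ "\<lambda>x. if norm (f x - y) < e then y else s x"]) auto
  qed
  moreover obtain Y where "finite Y" "f ` K \<subseteq> (\<Union>y\<in>Y. ball y e)"
  proof -
    have "compact (f ` K)"
      using assms(3,4) by (meson compact_continuous_image continuous_on_subset subset_UNIV)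
    then show ?thesis using that assms(5) unfolding compact_eq_totally_bounded by metis
  qed
  ultimately obtain s where "simple_function M s"
    "\<forall>x. (\<exists>y\<in>Y. norm (f x - y) < e) \<longrightarrow> norm (f x - s x) < e" by blast
  moreover have "\<exists>y\<in>Y. norm (f x - y) < e" if "x \<in> K" for x
    using \<open>f ` K \<subseteq> _\<close> that by (fastforce simp: dist_norm norm_minus_commute)
  ultimately show ?thesis
    by (intro exI[of _ s]) (auto intro!: simple_bochner_integrable.intros)
qed

lemma nn_integral_le_const_AE:
  assumes "prob_space M" "AE x in M. f x \<le> e"
  shows "(\<integral>\<^sup>+x. ennreal (f x) \<partial>M) \<le> ennreal e"
proof -
  interpret prob_space M by fact
  have "(\<integral>\<^sup>+x. ennreal (f x) \<partial>M) \<le> (\<integral>\<^sup>+x. ennreal e \<partial>M)"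
    using assms(2) by (intro nn_integral_mono_AE) (auto intro: ennreal_leI)
  then show ?thesis by (simp add: emeasure_space_1)
qed

text \<open>Simple functions within \<open>1 / (n + 1)\<close> of \<open>f\<close> on the compact
  set have a Cauchy sequence of integrals, and completeness of the target supplies the
  limit.\<close>

lemma has_bochner_int_continuous:
  fixes f :: "'g::topological_space \<Rightarrow> 'e::banach"
  assumes "compactly_supported M" and f: "continuous_on UNIV f"
  shows "\<exists>v. has_bochner_int M f v"
proof -
  obtain K where prob: "prob_space M" and sets: "sets M = sets borel"
    and K: "compact K" "AE x in M. x \<in> K"
    using assms(1) by (auto simp: compactly_supported_def)
  have fm: "f \<in> borel_measurable M"
    using borel_measurable_continuous_onI[OF f] measurable_cong_sets[OF sets refl] by blast
  have "\<forall>n::nat. \<exists>s. simple_integrable M s \<and> (\<forall>x\<in>K. norm (f x - s x) < inverse (real (Suc n)))"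
    using simple_approximation_on_compact[OF prob sets f K(1)] by simp
  then obtain s where s: "\<And>n::nat. simple_integrable M (s n)"
    "\<And>n x. x \<in> K \<Longrightarrow> norm (f x - s n x) < inverse (real (Suc n))" by metis
  have le: "(\<integral>\<^sup>+x. norm (f x - s n x) \<partial>M) \<le> ennreal (inverse (real (Suc n)))" for n
    by (intro nn_integral_le_const_AE[OF prob] eventually_mono[OF K(2)] less_imp_le[OF s(2)])
  have d: "norm (simple_integral M (s m) - simple_integral M (s n))
      \<le> inverse (real (Suc m)) + inverse (real (Suc n))" for m n
  proof -
    have "ennreal (norm (simple_integral M (s m) - simple_integral M (s n)))
        \<le> ennreal (inverse (real (Suc m))) + ennreal (inverse (real (Suc n)))"
      using order_trans[OF norm_simple_bochner_integral_diff_le[OF fm s(1) s(1)] add_mono[OF le le]] .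
    also have "\<dots> = ennreal (inverse (real (Suc m)) + inverse (real (Suc n)))"
      by (rule ennreal_plus[symmetric]) auto
    finally show ?thesis by (subst (asm) ennreal_le_iff) auto
  qed
  have "Cauchy (\<lambda>n. simple_integral M (s n))"
  proof (rule CauchyI)
    fix e :: real assume "0 < e"
    then obtain N where N: "inverse (real (Suc N)) < e / 2"
      using reals_Archimedean[of "e / 2"] by auto
    have "norm (simple_integral M (s m) - simple_integral M (s n)) < e"
      if "m \<ge> N" "n \<ge> N" for m n
    proof -
      have "inverse (real (Suc m)) \<le> inverse (real (Suc N))" "inverse (real (Suc n)) \<le> inverse (real (Suc N))"
        using that by (auto intro!: le_imp_inverse_le)
      then show ?thesis using d[of m n] N by linarith
    qed
    then show "\<exists>M'. \<forall>m\<ge>M'. \<forall>n\<ge>M'. norm (simple_integral M (s m) - simple_integral M (s n)) < e"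
      by blast
  qed
  then obtain v where "(\<lambda>n. simple_integral M (s n)) \<longlonglongrightarrow> v"
    using Cauchy_convergent convergent_def by blast
  moreover have "(\<lambda>n. \<integral>\<^sup>+x. norm (f x - s n x) \<partial>M) \<longlonglongrightarrow> 0"
    using tendsto_ennrealI[OF LIMSEQ_inverse_real_of_nat]
    by (intro tendsto_0_le_ennreal[OF _ le]) auto
  ultimately show ?thesis
    unfolding has_bochner_int_def by (intro exI[of _ v] conjI fm exI[of _ s] allI s(1))
qed

subsection \<open>Convolution\<close>

text \<open>The preimage is the set written \<open>x^-1 A\<close> in multiplicative notation. The
  property makes the integrand in the definition of the convolution Borel, indeed
  continuous.\<close>

definition continuous_translates :: "'g::topological_group_add measure \<Rightarrow> bool" where
  "continuous_translates \<mu> \<longleftrightarrow> (\<forall>A\<in>sets borel. continuous_on UNIV (\<lambda>x. measure \<mu> ((+) x -` A)))"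

lemma borel_vimage_translate:
  fixes A :: "'g::topological_group_add set"
  assumes "A \<in> sets borel"
  shows "(+) x -` A \<in> sets borel"
  using measurable_sets[OF borel_measurable_continuous_onI[of "(+) x"] assms]
  by (simp add: continuous_intros)

text \<open>By left invariance of \<open>M\<close>, the measure of \<open>x\<^sup>-\<^sup>1A\<close> is the integral over \<open>A\<close> of a
  translate of the density, and these translates converge uniformly with supports in a common
  compact set.\<close>
lemma continuous_translates_density:
  fixes \<mu> :: "'g::{topological_group_add, t2_space} measure"
  assumes lc: "locally_compact_space (euclidean :: 'g topology)"
    and prob: "prob_space \<mu>"
    and haar: "left_haar_measure M" and \<rho>: "continuous_on UNIV \<rho>" "\<And>x. 0 \<le> \<rho> x"
    and K: "compact (closure {x. \<rho> x \<noteq> 0})" and \<mu>: "\<mu> = density M (\<lambda>x. ennreal (\<rho> x))"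
  shows "continuous_translates \<mu>"
  unfolding continuous_translates_def
proof
  fix A :: "'g set" assume A: "A \<in> sets borel"
  interpret prob_space \<mu> by fact
  have sets_M[measurable_cong]: "sets M = sets borel" and inv: "\<And>a. distr M borel ((+) a) = M"
    and cpt: "\<And>K. compact K \<Longrightarrow> emeasure M K < \<infinity>"
    using haar by (auto simp: left_haar_measure_def)
  define \<phi> where "\<phi> x z = \<rho> (- x + z) * indicator A z" for x z
  have "continuous_on UNIV (\<lambda>z. \<rho> (- x + z))" for x
    by (rule continuous_on_compose2[OF \<rho>(1)]) (auto intro!: continuous_intros)
  note [measurable] = borel_measurable_continuous_onI[OF this] borel_measurable_continuous_onI[OF \<rho>(1)] A
    borel_vimage_translate[OF A]
  have trans_meas[measurable]: "(+) x \<in> measurable M borel" for x :: 'g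
    using borel_measurable_continuous_onI[of "(+) x"] by (simp add: continuous_intros)
  have \<phi>_meas[measurable]: "\<phi> x \<in> borel_measurable M" for x unfolding \<phi>_def by measurable
  \<comment> \<open>The substitution \<open>z = x + y\<close>, justified by left invariance of
    \<open>M\<close>, moves the translation from the set \<open>A\<close> to the density.\<close>
  have nn: "emeasure \<mu> ((+) x -` A) = (\<integral>\<^sup>+z. ennreal (\<phi> x z) \<partial>M)" for x
  proof -
    have "emeasure \<mu> ((+) x -` A) = (\<integral>\<^sup>+y. ennreal (\<rho> y) * indicator ((+) x -` A) y \<partial>M)"
      unfolding \<mu> by (intro emeasure_density) auto
    also have "\<dots> = (\<integral>\<^sup>+y. ennreal (\<phi> x (x + y)) \<partial>M)"
      by (intro nn_integral_cong) (auto simp: \<phi>_def indicator_def add.assoc[symmetric])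
    also have "\<dots> = (\<integral>\<^sup>+z. ennreal (\<phi> x z) \<partial>distr M borel ((+) x))"
      by (subst nn_integral_distr) (auto simp: \<phi>_def)
    finally show ?thesis by (simp add: inv)
  qed
  have nonneg: "0 \<le> \<phi> x z" for x z using \<rho>(2) by (auto simp: \<phi>_def)
  have int: "integrable M (\<phi> x)" for x
    using nonneg nn[of x] emeasure_finite[of "(+) x -` A"] by (intro integrableI_nonneg) (auto simp: less_top)
  have meas: "measure \<mu> ((+) x -` A) = (\<integral>z. \<phi> x z \<partial>M)" for x
    using nonneg nn[of x] by (simp add: measure_def integral_eq_nn_integral)
  have "\<exists>S. open S \<and> x\<^sub>0 \<in> S \<and> (\<forall>x\<in>S. dist (measure \<mu> ((+) x -` A)) (measure \<mu> ((+) x\<^sub>0 -` A)) < e)"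
    if e: "e > 0" for x\<^sub>0 e
  proof -
    obtain U V where UV: "open U" "compact V" "x\<^sub>0 \<in> U" "U \<subseteq> V"
      using lc unfolding locally_compact_space_def by (auto, meson)
    \<comment> \<open>For every \<open>y\<close> in \<open>U\<close> the density translated by
      \<open>y\<close> vanishes outside this one compact set.\<close>
    define C where "C = (\<lambda>(x, y). x + y) ` (V \<times> closure {x. \<rho> x \<noteq> 0})"
    have "compact C" unfolding C_def
      by (intro compact_continuous_image compact_Times UV K) (auto intro!: continuous_intros simp: split_beta)
    then have C_sets: "C \<in> sets M" using sets_M by (simp add: compact_imp_closed borel_closed)
    \<comment> \<open>Chosen so that \<open>d * measure M C < e\<close>; the added 1 covers the case
      that \<open>C\<close> has measure zero.\<close>
    define d where "d = e / (measure M C + 1)"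
    have d: "d > 0" using e by (simp add: d_def add_nonneg_pos)
    \<comment> \<open>Joint continuity together with compactness of \<open>C\<close> gives closeness
      at \<open>x\<^sub>0\<close> uniformly in \<open>z\<close>.\<close>
    have "continuous_on (UNIV \<times> C) (\<lambda>p. \<rho> (- fst p + snd p))"
      by (rule continuous_on_compose2[OF \<rho>(1)]) (auto intro!: continuous_intros)
    then obtain X where X: "x\<^sub>0 \<in> X" "open X"
      and "\<forall>x\<in>X \<inter> UNIV. \<forall>z\<in>C. dist (\<rho> (- fst (x, z) + snd (x, z))) (\<rho> (- fst (x\<^sub>0, z) + snd (x\<^sub>0, z))) \<le> d"
      by (rule continuous_on_prod_compactE[OF _ \<open>compact C\<close> UNIV_I d])
    then have Xd: "dist (\<rho> (- x + z)) (\<rho> (- x\<^sub>0 + z)) \<le> d" if "x \<in> X" "z \<in> C" for x z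
      using that by simp
    have "dist (measure \<mu> ((+) x -` A)) (measure \<mu> ((+) x\<^sub>0 -` A)) < e" if x: "x \<in> X \<inter> U" for x
    proof -
      have zero: "\<rho> (- y + z) = 0" if "y \<in> U" "z \<notin> C" for y z
      proof (rule ccontr)
        assume "\<rho> (- y + z) \<noteq> 0"
        then have "- y + z \<in> closure {x. \<rho> x \<noteq> 0}" by (intro subsetD[OF closure_subset]) simp
        then have "(y, - y + z) \<in> V \<times> closure {x. \<rho> x \<noteq> 0}" using \<open>y \<in> U\<close> UV(4) by auto
        then have "z \<in> C" unfolding C_def
          by (rule rev_image_eqI) (simp add: add.assoc[symmetric])
        with that show False by simp
      qed
      have pw: "norm (\<phi> x z - \<phi> x\<^sub>0 z) \<le> d * indicator C z" for z
        using Xd[of x z] zero[of x z] zero[of x\<^sub>0 z] x UV(3) d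
        by (auto simp: \<phi>_def indicator_def dist_real_def)
      have Cfin: "emeasure M C < \<infinity>" using cpt[OF \<open>compact C\<close>] .
      have "dist (measure \<mu> ((+) x -` A)) (measure \<mu> ((+) x\<^sub>0 -` A)) = norm (\<integral>z. \<phi> x z - \<phi> x\<^sub>0 z \<partial>M)"
        using int by (simp add: meas dist_real_def)
      also have "\<dots> \<le> (\<integral>z. d * indicator C z \<partial>M)"
        using int pw Cfin C_sets
        by (intro order_trans[OF integral_norm_bound] integral_mono integrable_norm
            Bochner_Integration.integrable_diff integrable_mult_right integrable_real_indicator) auto
      also have "\<dots> = d * measure M C" using C_sets by (simp add: sets_eq_imp_space_eq[OF sets_M])
      also have "\<dots> < e"
        using e by (simp add: d_def pos_divide_less_eq add_nonneg_pos)
      finally show ?thesis .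
    qed
    then show ?thesis using X UV by (intro exI[of _ "X \<inter> U"]) auto
  qed
  note nbhd = this
  show "continuous_on UNIV (\<lambda>x. measure \<mu> ((+) x -` A))"
    unfolding continuous_on_def
  proof (intro ballI tendstoI)
    fix x\<^sub>0 :: 'g and e :: real assume "0 < e"
    then obtain S where "open S" "x\<^sub>0 \<in> S"
      "\<And>x. x \<in> S \<Longrightarrow> dist (measure \<mu> ((+) x -` A)) (measure \<mu> ((+) x\<^sub>0 -` A)) < e"
      using nbhd by metis
    then show "\<forall>\<^sub>F x in at x\<^sub>0. dist (measure \<mu> ((+) x -` A)) (measure \<mu> ((+) x\<^sub>0 -` A)) < e"
      by (intro eventually_at_topological[THEN iffD2] exI[of _ S]) simp
  qed
qed

lemma compactly_supported_density:
  assumes "prob_space \<mu>" "sets M = sets borel" "continuous_on UNIV \<rho>"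
    and K: "compact (closure {x. \<rho> x \<noteq> (0::real)})" and \<mu>: "\<mu> = density M (\<lambda>x. ennreal (\<rho> x))"
  shows "compactly_supported \<mu>"
proof -
  have [measurable]: "\<rho> \<in> borel_measurable M"
    using borel_measurable_continuous_onI[OF assms(3)] assms(2) by (simp cong: measurable_cong_sets)
  have "AE x in \<mu>. x \<in> closure {x. \<rho> x \<noteq> 0}"
    unfolding \<mu> by (subst AE_density) (auto intro!: AE_I2 subsetD[OF closure_subset])
  then show ?thesis using assms by (auto simp: compactly_supported_def)
qed

section \<open>The convolution as a compactly supported measure\<close>

lemma sets_group_convolution: "sets (group_convolution \<nu> \<mu>) = sets borel"
  unfolding group_convolution_def
  using sets.sets_measure_of_eq[of borel] by simp

lemma space_group_convolution: "space (group_convolution \<nu> \<mu>) = UNIV"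
  using sets_eq_imp_space_eq[OF sets_group_convolution] by simp

text \<open>\<open>measure_of\<close> takes the prescribed values once countable additivity is
  known. Continuity of translates makes the integrands measurable, so that sum and integral may be
  exchanged.\<close>

lemma emeasure_group_convolution:
  fixes \<mu> \<nu> :: "'g::topological_group_add measure"
  assumes "finite_measure \<mu>" and ct: "continuous_translates \<mu>"
    and \<mu>: "sets \<mu> = sets borel" and \<nu>: "sets \<nu> = sets borel" and A: "A \<in> sets borel"
  shows "emeasure (group_convolution \<nu> \<mu>) A = (\<integral>\<^sup>+x. emeasure \<mu> ((+) x -` A) \<partial>\<nu>)"
proof -
  interpret finite_measure \<mu> by fact
  have meas: "(\<lambda>x. emeasure \<mu> ((+) x -` A)) \<in> borel_measurable \<nu>" if "A \<in> sets borel" for A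
  proof -
    have "(\<lambda>x. measure \<mu> ((+) x -` A)) \<in> borel_measurable borel"
      using ct that by (intro borel_measurable_continuous_onI) (auto simp: continuous_translates_def)
    then have "(\<lambda>x. measure \<mu> ((+) x -` A)) \<in> borel_measurable \<nu>"
      using \<nu> by (simp cong: measurable_cong_sets)
    then show ?thesis by (simp add: emeasure_eq_measure)
  qed
  let ?m = "\<lambda>A. \<integral>\<^sup>+x. emeasure \<mu> ((+) x -` A) \<partial>\<nu>"
  have "countably_additive (sets borel) ?m"
  proof (rule countably_additiveI)
    fix F :: "nat \<Rightarrow> 'g set"
    assume F: "range F \<subseteq> sets borel" "disjoint_family F"
    have "(\<Sum>i. ?m (F i)) = (\<integral>\<^sup>+x. (\<Sum>i. emeasure \<mu> ((+) x -` F i)) \<partial>\<nu>)"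
      using F by (intro nn_integral_suminf[symmetric] meas) auto
    also have "\<dots> = ?m (\<Union>i. F i)"
    proof (intro nn_integral_cong)
      fix x
      have "(\<Sum>i. emeasure \<mu> ((+) x -` F i)) = emeasure \<mu> (\<Union>i. (+) x -` F i)"
        using F \<mu> borel_vimage_translate[of _ x]
        by (intro suminf_emeasure) (auto simp: disjoint_family_on_def)
      then show "(\<Sum>i. emeasure \<mu> ((+) x -` F i)) = emeasure \<mu> ((+) x -` (\<Union>i. F i))"
        by (simp add: vimage_UN)
    qed
    finally show "(\<Sum>i. ?m (F i)) = ?m (\<Union>i. F i)" .
  qed
  moreover have "positive (sets borel) ?m" by (simp add: positive_def)
  moreover have "sigma_algebra UNIV (sets (borel :: 'g measure))"
    using sets.sigma_algebra_axioms[of borel] by simp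
  ultimately show ?thesis
    unfolding group_convolution_def using A by (intro emeasure_measure_of_sigma)
qed

lemma compactly_supported_return: "compactly_supported (return borel (a :: 'g::t1_space))"
  unfolding compactly_supported_def
  by (intro conjI exI[of _ "{a}"] prob_space_return) (auto simp: AE_return)

text \<open>For \<open>x\<close> in \<open>K\<close>, translating the complement of \<open>C\<close>
  back by \<open>x\<close> misses \<open>L\<close>, so its inner measure is zero. The set
  \<open>C\<close> is exposed because approximations are later made on it.\<close>

lemma compactly_supported_group_convolution:
  fixes \<mu> \<nu> :: "'g::{topological_group_add, t2_space} measure"
  assumes \<nu>: "compactly_supported \<nu>" "compact K" "AE x in \<nu>. x \<in> K"
    and \<mu>: "compactly_supported \<mu>" "continuous_translates \<mu>" "compact L" "AE x in \<mu>. x \<in> L"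
  defines "C \<equiv> (\<lambda>(x, y). x + y) ` (K \<times> L)"
  shows "compactly_supported (group_convolution \<nu> \<mu>)" "compact C"
    "AE x in group_convolution \<nu> \<mu>. x \<in> C"
proof -
  interpret \<mu>: prob_space \<mu> using \<mu> by (simp add: compactly_supported_def)
  interpret \<nu>: prob_space \<nu> using \<nu> by (simp add: compactly_supported_def)
  have s: "sets \<mu> = sets borel" "sets \<nu> = sets borel"
    using \<mu> \<nu> by (auto simp: compactly_supported_def)
  have sp: "space \<mu> = UNIV" "space \<nu> = UNIV" "space (group_convolution \<nu> \<mu>) = UNIV"
    using s by (auto dest!: sets_eq_imp_space_eq simp: space_group_convolution)
  note em = emeasure_group_convolution[OF \<mu>.finite_measure_axioms \<mu>(2) s]
  show C: "compact C" unfolding C_def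
    by (intro compact_continuous_image compact_Times \<nu> \<mu>) (auto intro!: continuous_intros simp: split_beta)
  then have Cb: "C \<in> sets borel" by (simp add: compact_imp_closed borel_closed)
  have p: "prob_space (group_convolution \<nu> \<mu>)"
    using em[of UNIV] \<mu>.emeasure_space_1 \<nu>.emeasure_space_1 sp by (intro prob_spaceI) simp
  have "emeasure (group_convolution \<nu> \<mu>) (- C) = (\<integral>\<^sup>+x. emeasure \<mu> ((+) x -` (- C)) \<partial>\<nu>)"
    using Cb by (intro em) auto
  also have "\<dots> = (\<integral>\<^sup>+x. 0 \<partial>\<nu>)"
  proof (intro nn_integral_cong_AE eventually_mono[OF \<nu>(3)])
    fix x assume x: "x \<in> K"
    have "(+) x -` (- C) \<in> sets \<mu>" using Cb s borel_vimage_translate[of "- C"] by simp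
    moreover have "AE y in \<mu>. y \<notin> (+) x -` (- C)"
      using \<mu>(4) by eventually_elim (use x in \<open>force simp: C_def\<close>)
    ultimately show "emeasure \<mu> ((+) x -` (- C)) = 0" using AE_iff_null_sets by blast
  qed
  finally have "- C \<in> null_sets (group_convolution \<nu> \<mu>)"
    using Cb by (auto simp: null_sets_def sets_group_convolution)
  then have "AE x in group_convolution \<nu> \<mu>. x \<notin> - C" by (rule AE_not_in)
  then show ae: "AE x in group_convolution \<nu> \<mu>. x \<in> C" by simp
  show "compactly_supported (group_convolution \<nu> \<mu>)"
    unfolding compactly_supported_def using p C ae sets_group_convolution by blast
qed

lemma measurable_continuous_compactly_supported:
  "compactly_supported M \<Longrightarrow> continuous_on UNIV f \<Longrightarrow> f \<in> borel_measurable M"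
  using borel_measurable_continuous_onI measurable_cong_sets[OF _ refl]
  unfolding compactly_supported_def by blast

section \<open>Iterated integrals and convolution\<close>

text \<open>Continuity of the summands provides the measurability of partial sums that additivity
  requires.\<close>

lemma has_bochner_int_sum:
  fixes u :: "'i \<Rightarrow> 'g::topological_space \<Rightarrow> 'e::real_normed_vector"
  assumes M: "compactly_supported M"
    and "\<And>i. i \<in> I \<Longrightarrow> continuous_on UNIV (u i)" "\<And>i. i \<in> I \<Longrightarrow> has_bochner_int M (u i) (c i)"
  shows "has_bochner_int M (\<lambda>x. \<Sum>i\<in>I. u i x) (\<Sum>i\<in>I. c i)"
  using assms(2,3)
proof (induction I rule: infinite_finite_induct)
  case (insert i I)
  have "has_bochner_int M (\<lambda>x. u i x + (\<Sum>i\<in>I. u i x)) (c i + (\<Sum>i\<in>I. c i))"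
    using insert
    by (intro has_bochner_int_add measurable_continuous_compactly_supported[OF M])
       (auto intro!: continuous_intros)
  then show ?case using insert by simp
qed (use M has_bochner_int_const[of M 0] in \<open>auto simp: compactly_supported_def\<close>)

text \<open>Uniform approximation of \<open>f\<close> by a simple function on the support reduces this to indicator
  functions, where it is the definition of the convolution.\<close>
lemma has_bochner_int_group_convolution:
  fixes \<mu> \<nu> :: "'g::{topological_group_add, t2_space} measure" and f :: "'g \<Rightarrow> 'e::banach"
  assumes \<nu>: "compactly_supported \<nu>"
    and \<mu>: "compactly_supported \<mu>" "continuous_translates \<mu>"
    and f: "continuous_on UNIV f" and h: "continuous_on UNIV h"
    and inner: "\<And>x. has_bochner_int \<mu> (\<lambda>y. f (x + y)) (h x)"
    and outer: "has_bochner_int \<nu> h v"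
  shows "has_bochner_int (group_convolution \<nu> \<mu>) f v"
proof -
  interpret \<mu>: prob_space \<mu> using \<mu> by (simp add: compactly_supported_def)
  interpret \<nu>: prob_space \<nu> using \<nu> by (simp add: compactly_supported_def)
  let ?N = "group_convolution \<nu> \<mu>"
  have s: "sets \<mu> = sets borel" "sets \<nu> = sets borel"
    using \<mu> \<nu> by (auto simp: compactly_supported_def)
  have sp: "space \<mu> = UNIV" "space \<nu> = UNIV" "space ?N = UNIV"
    using s by (auto dest!: sets_eq_imp_space_eq simp: space_group_convolution)
  note em = emeasure_group_convolution[OF \<mu>.finite_measure_axioms \<mu>(2) s]
  obtain K L where K: "compact K" "AE x in \<nu>. x \<in> K" and L: "compact L" "AE x in \<mu>. x \<in> L"
    using \<mu> \<nu> by (auto simp: compactly_supported_def)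
  define C where "C = (\<lambda>(x, y). x + y) ` (K \<times> L)"
  note N = compactly_supported_group_convolution[OF \<nu> K \<mu> L, folded C_def]
  have probN: "prob_space ?N" using N(1) by (simp add: compactly_supported_def)
  obtain w where w: "has_bochner_int ?N f w"
    using has_bochner_int_continuous[OF N(1) f] by blast
  \<comment> \<open>An integral \<open>w\<close> exists by continuity of \<open>f\<close>. Both
    \<open>w\<close> and \<open>v\<close> are shown to lie within \<open>e\<close> of the integral
    of one simple function \<open>t\<close>.\<close>
  have "norm (w - v) \<le> e + e" if e: "e > 0" for e
  proof -
    obtain t where t: "simple_integrable ?N t" "\<And>x. x \<in> C \<Longrightarrow> norm (f x - t x) < e"
      using simple_approximation_on_compact[OF probN sets_group_convolution f N(2) e] by blast
    have fin: "finite (range t)" and lev: "\<And>y. {x. t x = y} \<in> sets borel"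
    proof -
      have sf: "simple_function ?N t" using t(1) by (simp add: simple_bochner_integrable.simps)
      then show "finite (range t)" using sp by (simp add: simple_function_def)
      show "{x. t x = y} \<in> sets borel" for y
        using simple_functionD(2)[OF sf, of "{y}"] sp sets_group_convolution[of \<nu> \<mu>]
        by (simp add: vimage_def)
    qed
    let ?T = "simple_integral ?N t"
    have wT: "norm (w - ?T) \<le> e"
    proof -
      have "ennreal (norm (w - ?T)) \<le> (\<integral>\<^sup>+x. norm (f x - t x) \<partial>?N)"
        by (rule norm_has_bochner_int_diff_simple_le[OF w t(1)])
      also have "\<dots> \<le> ennreal e"
        by (intro nn_integral_le_const_AE[OF probN] eventually_mono[OF N(3)] less_imp_le t(2))
      finally show ?thesis using e by simp
    qed
    have trans_simple: "simple_integrable \<mu> (\<lambda>y. t (x + y))" for x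
    proof -
      have "(\<lambda>y. t (x + y)) ` space \<mu> \<subseteq> range t" by auto
      moreover have "(\<lambda>y. t (x + y)) -` {z} \<inter> space \<mu> \<in> sets \<mu>" for z
        using borel_vimage_translate[OF lev[of z], of x] s sp by (simp add: vimage_def)
      ultimately have "simple_function \<mu> (\<lambda>y. t (x + y))"
        using fin finite_subset by (auto simp: simple_function_def)
      then show ?thesis by (auto intro!: simple_bochner_integrable.intros)
    qed
    define \<phi> where "\<phi> y x = measure \<mu> ((+) x -` {z. t z = y})" for y x
    define u where "u x = (\<Sum>y\<in>range t. \<phi> y x *\<^sub>R y)" for x
    have u_eq: "simple_integral \<mu> (\<lambda>y. t (x + y)) = u x" for x
    proof -
      \<comment> \<open>Left translation is a bijection, so every translate of \<open>t\<close> has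
        the same values and its integral is a sum over the fixed index set
        \<open>range t\<close>.\<close>
      have "range (\<lambda>y. t (x + y)) = range t"
      proof safe
        fix z show "t z \<in> range (\<lambda>y. t (x + y))"
          by (rule range_eqI[of _ _ "- x + z"]) (simp add: add.assoc[symmetric])
      qed auto
      then show ?thesis
        by (simp add: simple_bochner_integral_def u_def \<phi>_def sp vimage_def)
    qed
    have hu: "norm (h x - u x) \<le> e" if "x \<in> K" for x
    proof -
      have "ennreal (norm (h x - u x)) \<le> (\<integral>\<^sup>+y. norm (f (x + y) - t (x + y)) \<partial>\<mu>)"
        using norm_has_bochner_int_diff_simple_le[OF inner trans_simple] by (simp add: u_eq)
      also have "\<dots> \<le> ennreal e"
        using that
        by (intro nn_integral_le_const_AE[OF \<mu>.prob_space_axioms] eventually_mono[OF L(2)] less_imp_le t(2))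
           (auto simp: C_def)
      finally show ?thesis using e by simp
    qed
    have cont_\<phi>: "continuous_on UNIV (\<phi> y)" for y
      using \<mu>(2) lev unfolding \<phi>_def continuous_translates_def by blast
    \<comment> \<open>Integrating the measures of the translated level sets against
      \<open>\<nu>\<close> is exactly the convolution measure of the level set.\<close>
    have int_\<phi>: "has_bochner_int \<nu> (\<phi> y) (measure ?N {x \<in> space ?N. t x = y})" for y
    proof (rule has_bochner_integral_imp_has_bochner_int, rule has_bochner_integral_nn_integral)
      show "\<phi> y \<in> borel_measurable \<nu>"
        by (intro measurable_continuous_compactly_supported \<nu> cont_\<phi>)
      have "emeasure ?N {z. t z = y} = (\<integral>\<^sup>+x. ennreal (\<phi> y x) \<partial>\<nu>)"
        by (subst em[OF lev]) (simp add: \<phi>_def \<mu>.emeasure_eq_measure)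
      then show "(\<integral>\<^sup>+x. ennreal (\<phi> y x) \<partial>\<nu>) = ennreal (measure ?N {x \<in> space ?N. t x = y})"
        using sp prob_space.finite_measure[OF probN] by (simp add: finite_measure.emeasure_eq_measure)
    qed (auto simp: \<phi>_def)
    have cont_u: "continuous_on UNIV u"
      unfolding u_def by (intro continuous_intros cont_\<phi>)
    have "has_bochner_int \<nu> u ?T"
      unfolding u_def simple_bochner_integral_def sp
      by (intro has_bochner_int_sum[OF \<nu>] continuous_intros cont_\<phi>
          has_bochner_int_bounded_linear[OF bounded_linear_scaleR_left] int_\<phi>[unfolded sp])
    then have "has_bochner_int \<nu> (\<lambda>x. - u x) (- ?T)"
      by (intro has_bochner_int_bounded_linear[OF bounded_linear_minus[OF bounded_linear_ident]])
    \<comment> \<open>Since \<open>hu\<close> holds on \<open>K\<close>, which carries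
      \<open>\<nu>\<close>, the mean of \<open>h - u\<close> has norm at most
      \<open>e\<close>.\<close>
    then have "has_bochner_int \<nu> (\<lambda>x. h x + - u x) (v + - ?T)"
      by (intro has_bochner_int_add outer measurable_continuous_compactly_supported[OF \<nu>]
          continuous_intros h cont_u)
    then have "norm (v + - ?T) \<le> e"
      by (rule norm_has_bochner_int_le_bound[OF \<nu>.prob_space_axioms])
         (use e hu in \<open>auto intro: eventually_mono[OF K(2)]\<close>)
    with wT show ?thesis
      using norm_triangle_ineq4[of "w - ?T" "v - ?T"] by simp
  qed
  from this[of "e / 2" for e] have "norm (w - v) \<le> e" if "e > 0" for e using that by simp
  then have "norm (w - v) \<le> 0" by (rule field_le_epsilon) simp
  with w show ?thesis by simp
qed

subsection \<open>Representations and cocycles\<close>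

text \<open>Some integral \<open>w\<close> exists; subtracting the constant \<open>f a\<close>
  leaves a function vanishing almost everywhere, which forces \<open>w = f a\<close>.\<close>

lemma has_bochner_int_return:
  fixes f :: "'g::t1_space \<Rightarrow> 'e::banach"
  assumes "continuous_on UNIV f"
  shows "has_bochner_int (return borel a) f (f a)"
proof -
  have c: "compactly_supported (return borel a)" by (rule compactly_supported_return)
  then have p: "prob_space (return borel a)" by (simp add: compactly_supported_def)
  obtain w where w: "has_bochner_int (return borel a) f w"
    using has_bochner_int_continuous[OF c assms] by blast
  have "has_bochner_int (return borel a) (\<lambda>x. f x + - f a) (w + - f a)"
    by (intro has_bochner_int_add w has_bochner_int_const p
        measurable_continuous_compactly_supported[OF c] continuous_intros assms)
  moreover have "AE x in return borel a. norm (f x + - f a) \<le> 0"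
    by (rule eventually_mono[of "\<lambda>x. x = a"]) (auto simp: AE_return)
  ultimately have "norm (w + - f a) \<le> 0"
    using norm_has_bochner_int_le_bound[OF p] by blast
  with w show ?thesis by simp
qed

section \<open>Representations, coboundaries and triviality of H1\<close>

context
  fixes \<pi> :: "'g::{topological_group_add, t2_space} \<Rightarrow> 'e::banach \<Rightarrow>\<^sub>L 'e"
  assumes rep: "strongly_continuous_representation \<pi>"
begin

lemma representation_add: "\<pi> (g + h) v = \<pi> g (\<pi> h v)"
  using rep by (simp add: strongly_continuous_representation_def)

text \<open>The operator \<open>\<pi> 0\<close> is idempotent, and an idempotent with a left inverse
  is the identity.\<close>

lemma representation_zero: "\<pi> 0 v = v"
proof -
  obtain T where "T o\<^sub>L \<pi> 0 = id_blinfun"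
    using rep by (metis strongly_continuous_representation_def)
  then have T: "T (\<pi> 0 w) = w" for w
    by (metis blinfun_apply_blinfun_compose blinfun_apply_id_blinfun id_apply)
  have "\<pi> 0 (\<pi> 0 v) = \<pi> 0 v" using representation_add[of 0 0 v] by simp
  then show ?thesis by (metis T)
qed

lemma continuous_on_representation: "continuous_on UNIV (\<lambda>g. \<pi> g v)"
  using rep by (simp add: strongly_continuous_representation_def)

lemma B1_subset_Z1: "B1 \<pi> \<subseteq> Z1 \<pi>"
proof
  fix z assume "z \<in> B1 \<pi>"
  then obtain v where z: "z = (\<lambda>g. v - \<pi> g v)" unfolding B1_def by blast
  have "continuous_on UNIV z"
    unfolding z by (intro continuous_on_diff continuous_on_const continuous_on_representation)
  moreover have "z (g + h) = \<pi> g (z h) + z g" for g h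
    by (simp add: z representation_add blinfun.diff_right)
  ultimately show "z \<in> Z1 \<pi>" unfolding Z1_def by blast
qed

text \<open>The class of \<open>z\<close> is its coset modulo \<open>B1 \<pi>\<close>, and
  \<open>z\<close> lies in its own class. Hence all classes equal \<open>B1 \<pi>\<close> exactly
  when every cocycle is a coboundary.\<close>

lemma H1_trivial_iff: "H1 \<pi> = {B1 \<pi>} \<longleftrightarrow> Z1 \<pi> \<subseteq> B1 \<pi>"
proof -
  have zero: "(\<lambda>g. 0) \<in> B1 \<pi>"
    unfolding B1_def by (rule range_eqI[of _ _ 0]) simp
  have diff: "(\<lambda>g. z g - w g) \<in> B1 \<pi>" if z: "z \<in> B1 \<pi>" and w: "w \<in> B1 \<pi>" for z w
  proof -
    obtain a where "z = (\<lambda>g. a - \<pi> g a)" using z unfolding B1_def by blast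
    moreover obtain b where "w = (\<lambda>g. b - \<pi> g b)" using w unfolding B1_def by blast
    ultimately show ?thesis
      unfolding B1_def by (intro range_eqI[of _ _ "a - b"]) (auto simp: blinfun.diff_right)
  qed
  have cls: "cohomologous \<pi> `` {z} = {w \<in> Z1 \<pi>. (\<lambda>g. z g - w g) \<in> B1 \<pi>}" if "z \<in> Z1 \<pi>" for z
    using that by (auto simp: cohomologous_def)
  show ?thesis
  proof
    assume H: "H1 \<pi> = {B1 \<pi>}"
    show "Z1 \<pi> \<subseteq> B1 \<pi>"
    proof
      fix z assume z: "z \<in> Z1 \<pi>"
      then have "cohomologous \<pi> `` {z} \<in> H1 \<pi>"
        unfolding H1_def by (rule quotientI)
      then have "cohomologous \<pi> `` {z} = B1 \<pi>" using H by simp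
      moreover have "z \<in> cohomologous \<pi> `` {z}"
        using z zero cls by simp
      ultimately show "z \<in> B1 \<pi>" by blast
    qed
  next
    assume "Z1 \<pi> \<subseteq> B1 \<pi>"
    then have eq: "Z1 \<pi> = B1 \<pi>" using B1_subset_Z1 by blast
    have "cohomologous \<pi> `` {z} = B1 \<pi>" if "z \<in> B1 \<pi>" for z
      using cls[of z] that diff eq by auto
    \<comment> \<open>The zero cocycle shows that the quotient is nonempty, so it is the singleton
      and not the empty set.\<close>
    then show "H1 \<pi> = {B1 \<pi>}"
      using zero by (auto simp: H1_def quotient_def eq)
  qed
qed

text \<open>Strong continuity bounds each orbit over \<open>K\<close>, and uniform boundedness
  upgrades this to operator norms.\<close>

lemma representation_bounded_on_compact:
  assumes "compact K"
  shows "\<exists>C. \<forall>g\<in>K. norm (\<pi> g) \<le> C"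
proof (rule uniform_boundedness_principle)
  fix v
  have "compact ((\<lambda>g. \<pi> g v) ` K)"
    using assms continuous_on_representation by (meson compact_continuous_image continuous_on_subset subset_UNIV)
  then show "\<exists>C. \<forall>g\<in>K. norm (\<pi> g v) \<le> C"
    using compact_imp_bounded bounded_iff by (metis imageI)
qed

section \<open>The Markov operator and integrals against convolution powers\<close>

context
  fixes \<mu> :: "'g measure"
  assumes \<mu>: "compactly_supported \<mu>" "continuous_translates \<mu>"
begin

lemma has_bochner_int_markov_operator:
  "has_bochner_int \<mu> (\<lambda>g. \<pi> g v) (markov_operator \<pi> \<mu> v)"
  using has_bochner_int_continuous[OF \<mu>(1) continuous_on_representation, of v]
  by (auto simp: markov_operator_def bochner_int_eq)

text \<open>The bound of \<open>\<pi>\<close> on a compact set carrying \<open>\<mu>\<close> passes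
  to the average. Boundedness is what lets \<open>onorm\<close> act as an operator norm
  below.\<close>

lemma bounded_linear_markov_operator: "bounded_linear (markov_operator \<pi> \<mu>)"
proof -
  obtain K where p: "prob_space \<mu>" and K: "compact K" "AE x in \<mu>. x \<in> K"
    using \<mu> by (auto simp: compactly_supported_def)
  obtain C where C: "\<And>g. g \<in> K \<Longrightarrow> norm (\<pi> g) \<le> C"
    using representation_bounded_on_compact[OF K(1)] by blast
  show ?thesis
  proof (rule bounded_linear_intro)
    fix v w
    have "has_bochner_int \<mu> (\<lambda>g. \<pi> g v + \<pi> g w) (markov_operator \<pi> \<mu> v + markov_operator \<pi> \<mu> w)"
      by (intro has_bochner_int_add has_bochner_int_markov_operator
          measurable_continuous_compactly_supported[OF \<mu>(1)] continuous_on_add continuous_on_minus continuous_on_const continuous_on_representation)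
    then show "markov_operator \<pi> \<mu> (v + w) = markov_operator \<pi> \<mu> v + markov_operator \<pi> \<mu> w"
      using has_bochner_int_markov_operator[of "v + w"] has_bochner_int_unique
      by (auto simp: blinfun.add_right)
  next
    fix r v
    have "has_bochner_int \<mu> (\<lambda>g. r *\<^sub>R \<pi> g v) (r *\<^sub>R markov_operator \<pi> \<mu> v)"
      by (intro has_bochner_int_bounded_linear[OF bounded_linear_scaleR_right]
          has_bochner_int_markov_operator)
    then show "markov_operator \<pi> \<mu> (r *\<^sub>R v) = r *\<^sub>R markov_operator \<pi> \<mu> v"
      using has_bochner_int_markov_operator[of "r *\<^sub>R v"] has_bochner_int_unique
      by (auto simp: blinfun.scaleR_right)
  next
    fix v
    show "norm (markov_operator \<pi> \<mu> v) \<le> norm v * max C 0"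
    proof (rule norm_has_bochner_int_le_bound[OF p has_bochner_int_markov_operator])
      show "AE g in \<mu>. norm (\<pi> g v) \<le> norm v * max C 0"
        using K(2)
      proof eventually_elim
        fix g assume "g \<in> K"
        then have "norm (\<pi> g) \<le> max C 0" using C[of g] by simp
        then have "norm (\<pi> g) * norm v \<le> max C 0 * norm v" by (intro mult_right_mono) auto
        then show "norm (\<pi> g v) \<le> norm v * max C 0"
          using norm_blinfun[of "\<pi> g" v] by (simp add: mult.commute)
      qed
    qed simp
  qed
qed

lemma compactly_supported_convolution_power: "compactly_supported (convolution_power \<mu> n)"
proof (induction n)
  case (Suc n)
  obtain K L where "compact K" "AE x in convolution_power \<mu> n. x \<in> K" "compact L" "AE x in \<mu>. x \<in> L"
    using Suc \<mu> by (auto simp: compactly_supported_def)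
  then show ?case
    using compactly_supported_group_convolution(1)[OF Suc] \<mu> by simp
qed (simp add: compactly_supported_return)

text \<open>The factor \<open>\<mu>\<close> stands on the right, so integrating it out first
  replaces \<open>v\<close> by its image under the Markov operator; hence the induction is over
  arbitrary \<open>v\<close>.\<close>

lemma has_bochner_int_convolution_power_orbit:
  "has_bochner_int (convolution_power \<mu> n) (\<lambda>g. \<pi> g v) ((markov_operator \<pi> \<mu> ^^ n) v)"
proof (induction n arbitrary: v)
  case 0
  show ?case
    using has_bochner_int_return[OF continuous_on_representation, of 0 v] by (simp add: representation_zero)
next
  case (Suc n)
  have "has_bochner_int (group_convolution (convolution_power \<mu> n) \<mu>) (\<lambda>g. \<pi> g v)
      ((markov_operator \<pi> \<mu> ^^ n) (markov_operator \<pi> \<mu> v))"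
    by (rule has_bochner_int_group_convolution[OF compactly_supported_convolution_power \<mu>
          continuous_on_representation continuous_on_representation _ Suc])
       (simp add: representation_add has_bochner_int_bounded_linear[OF blinfun.bounded_linear_right]
          has_bochner_int_markov_operator)
  then show ?case by (simp add: funpow_swap1)
qed

text \<open>The cocycle identity makes \<open>z (g + h)\<close> a continuous affine function of
  \<open>z h\<close>; total mass one leaves the constant term \<open>z g\<close> unchanged.\<close>

lemma has_bochner_int_affine_cocycle:
  assumes M: "compactly_supported M" and z: "z \<in> Z1 \<pi>" and w: "has_bochner_int M z w"
  shows "has_bochner_int M (\<lambda>h. z (g + h)) (\<pi> g w + z g)"
proof -
  have cz: "continuous_on UNIV z" and eq: "\<And>h. z (g + h) = \<pi> g (z h) + z g"
    using z by (auto simp: Z1_def)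
  have p: "prob_space M" using M by (simp add: compactly_supported_def)
  have "continuous_on UNIV (\<lambda>h. \<pi> g (z h) + z g)"
    by (intro continuous_on_add continuous_on_const bounded_linear.continuous_on[OF blinfun.bounded_linear_right] cz)
  then show ?thesis
    unfolding eq
    by (rule has_bochner_int_add[OF has_bochner_int_bounded_linear[OF blinfun.bounded_linear_right w]
          has_bochner_int_const[OF p] measurable_continuous_compactly_supported[OF M]])
qed

text \<open>With \<open>w\<close> the integral of \<open>z\<close> against \<open>\<mu>\<close>,
  integrating out the last factor turns \<open>z g\<close> into \<open>\<pi> g w + z g\<close>. Each
  step thus adds one term of the Neumann series, starting from \<open>z 0 = 0\<close>.\<close>

lemma has_bochner_int_convolution_power_cocycle:
  assumes z: "z \<in> Z1 \<pi>"
  shows "has_bochner_int (convolution_power \<mu> n) z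
    (\<Sum>k<n. (markov_operator \<pi> \<mu> ^^ k) (bochner_int \<mu> z))"
proof (induction n)
  case 0
  have "z (0 + 0) = \<pi> 0 (z 0) + z 0" using z unfolding Z1_def by blast
  then have "z 0 = 0" by (simp add: representation_zero)
  moreover have "continuous_on UNIV z" using z unfolding Z1_def by blast
  ultimately show ?case using has_bochner_int_return[of z 0] by simp
next
  case (Suc n)
  have cz: "continuous_on UNIV z" using z unfolding Z1_def by blast
  define w where "w = bochner_int \<mu> z"
  have w: "has_bochner_int \<mu> z w"
    using has_bochner_int_continuous[OF \<mu>(1) cz] by (auto simp: w_def bochner_int_eq)
  note cs = compactly_supported_convolution_power
  have "has_bochner_int (convolution_power \<mu> n) (\<lambda>g. \<pi> g w + z g)
      ((markov_operator \<pi> \<mu> ^^ n) w + (\<Sum>k<n. (markov_operator \<pi> \<mu> ^^ k) w))"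
    using Suc[folded w_def]
    by (intro has_bochner_int_add has_bochner_int_convolution_power_orbit
        measurable_continuous_compactly_supported[OF cs] continuous_on_add continuous_on_minus continuous_on_const continuous_on_representation cz)
  then have "has_bochner_int (group_convolution (convolution_power \<mu> n) \<mu>) z
      ((markov_operator \<pi> \<mu> ^^ n) w + (\<Sum>k<n. (markov_operator \<pi> \<mu> ^^ k) w))"
    by (intro has_bochner_int_group_convolution[where h = "\<lambda>g. \<pi> g w + z g"] cs \<mu> cz
        has_bochner_int_affine_cocycle[OF \<mu>(1) z w] continuous_on_add continuous_on_minus continuous_on_const continuous_on_representation)
  then show ?case by (simp add: w_def add.commute)
qed

section \<open>Barycentres when the Markov operator is a contraction\<close>

context
  assumes contr: "onorm (markov_operator \<pi> \<mu>) < 1"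
begin

lemma norm_markov_operator_funpow_le:
  "norm ((markov_operator \<pi> \<mu> ^^ n) v) \<le> onorm (markov_operator \<pi> \<mu>) ^ n * norm v"
proof (induction n)
  case (Suc n)
  have "norm ((markov_operator \<pi> \<mu> ^^ Suc n) v)
      \<le> onorm (markov_operator \<pi> \<mu>) * norm ((markov_operator \<pi> \<mu> ^^ n) v)"
    using onorm[OF bounded_linear_markov_operator] by simp
  also have "\<dots> \<le> onorm (markov_operator \<pi> \<mu>) * (onorm (markov_operator \<pi> \<mu>) ^ n * norm v)"
    by (intro mult_left_mono Suc onorm_pos_le bounded_linear_markov_operator)
  finally show ?case by (simp add: mult.assoc)
qed simp

text \<open>A geometric series dominates. Its sum yields barycentres of cocycles, and its vanishing
  terms yield those of coboundaries.\<close>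

lemma summable_markov_operator_funpow: "summable (\<lambda>n. (markov_operator \<pi> \<mu> ^^ n) v)"
proof (rule summable_comparison_test')
  show "summable (\<lambda>n. onorm (markov_operator \<pi> \<mu>) ^ n * norm v)"
    using contr onorm_pos_le[OF bounded_linear_markov_operator]
    by (intro summable_mult2 summable_geometric) simp
qed (rule norm_markov_operator_funpow_le)

text \<open>For each \<open>n\<close> the integral of the translate is
  \<open>\<pi> \<gamma> (F n) + z \<gamma>\<close>, and this affine map is continuous. Convergence
  of \<open>F\<close> also ensures that each \<open>lim\<close> denotes an actual limit.\<close>

lemma barycentre_translate:
  assumes z: "z \<in> Z1 \<pi>"
  shows "barycentre \<mu> (translate \<gamma> z) = \<pi> \<gamma> (barycentre \<mu> z) + z \<gamma>"
proof -
  define F where "F n = (\<Sum>k<n. (markov_operator \<pi> \<mu> ^^ k) (bochner_int \<mu> z))" for n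
  have F: "has_bochner_int (convolution_power \<mu> n) z (F n)" for n
    unfolding F_def by (rule has_bochner_int_convolution_power_cocycle[OF z])
  obtain b where b: "F \<longlonglongrightarrow> b"
    using summable_LIMSEQ[OF summable_markov_operator_funpow] unfolding F_def by blast
  have "barycentre \<mu> z = b"
    unfolding barycentre_def bochner_int_eq[OF F] by (rule limI[OF b])
  moreover have "barycentre \<mu> (translate \<gamma> z) = \<pi> \<gamma> b + z \<gamma>"
    unfolding barycentre_def translate_def
      bochner_int_eq[OF has_bochner_int_affine_cocycle[OF compactly_supported_convolution_power z F]]
    by (intro limI tendsto_intros b)
  ultimately show ?thesis by simp
qed

text \<open>The integrals are \<open>v\<close> minus iterates of the Markov operator on
  \<open>v\<close>, which tend to zero. So a coboundary determines its vector
  \<open>v\<close>.\<close>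

lemma barycentre_coboundary: "barycentre \<mu> (\<lambda>g. v - \<pi> g v) = v"
proof -
  have "has_bochner_int (convolution_power \<mu> n) (\<lambda>g. v + - \<pi> g v) (v + - (markov_operator \<pi> \<mu> ^^ n) v)" for n
    using compactly_supported_convolution_power[of n]
    by (intro has_bochner_int_add has_bochner_int_const has_bochner_int_convolution_power_orbit
        has_bochner_int_bounded_linear[OF bounded_linear_minus[OF bounded_linear_ident]]
        measurable_continuous_compactly_supported continuous_on_add continuous_on_minus continuous_on_const continuous_on_representation)
       (auto simp: compactly_supported_def)
  from bochner_int_eq[OF this]
  have "barycentre \<mu> (\<lambda>g. v - \<pi> g v) = lim (\<lambda>n. v - (markov_operator \<pi> \<mu> ^^ n) v)"
    by (simp add: barycentre_def)
  also have "\<dots> = v"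
    using tendsto_diff[OF tendsto_const summable_LIMSEQ_zero[OF summable_markov_operator_funpow], of v v]
    by (intro limI) simp
  finally show ?thesis .
qed

end

end

end

section \<open>Triviality of H1 and invariance of barycentres\<close>

theorem mainTheorem2:
  fixes \<pi> :: "'g::{topological_group_add, t2_space} \<Rightarrow> 'e::banach \<Rightarrow>\<^sub>L 'e"
    and \<mu> :: "'g measure"
  assumes "locally_compact_space (euclidean :: 'g topology)"
    and "\<exists>K :: 'g set. compact K \<and> generates K"
    and "strongly_continuous_representation \<pi>"
    and "prob_space \<mu>"
    and "symmetric_measure \<mu>"
    and "has_continuous_compact_density \<mu>"
    and "generates (measure_support \<mu>)"
    and "onorm (markov_operator \<pi> \<mu>) < 1"
  shows "H1 \<pi> = {B1 \<pi>} \<longleftrightarrow>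
    (\<forall>z\<in>Z1 \<pi>. \<forall>\<gamma>. barycentre \<mu> (translate \<gamma> z) = barycentre \<mu> z)"
proof -
  note rep = assms(3) and contr = assms(8)
  obtain M \<rho> where haar: "left_haar_measure M" and \<rho>: "continuous_on UNIV \<rho>" "\<And>x. 0 \<le> \<rho> x"
    "compact (closure {x. \<rho> x \<noteq> (0::real)})" and \<mu>: "\<mu> = density M (\<lambda>x. ennreal (\<rho> x))"
    using assms(6) by (auto simp: has_continuous_compact_density_def)
  have "sets M = sets borel" using haar by (simp add: left_haar_measure_def)
  \<comment> \<open>The density enters through two properties of \<open>\<mu>\<close>: a compact set
    of full measure and continuity under translation.\<close>
  note cs = compactly_supported_density[OF assms(4) this \<rho>(1,3) \<mu>]
  note ct = continuous_translates_density[OF assms(1,4) haar \<rho> \<mu>]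
  note translate = barycentre_translate[OF rep cs ct contr]
  show ?thesis
    unfolding H1_trivial_iff[OF rep]
  proof (intro iffI ballI allI subsetI)
    fix z \<gamma> assume "Z1 \<pi> \<subseteq> B1 \<pi>" and z: "z \<in> Z1 \<pi>"
    then obtain v where "z = (\<lambda>g. v - \<pi> g v)" by (auto simp: B1_def)
    \<comment> \<open>The barycentre of the coboundary of \<open>v\<close> is \<open>v\<close>, and
      \<open>v\<close> is fixed by the affine map sending \<open>x\<close> to
      \<open>\<pi> \<gamma> x + z \<gamma>\<close>.\<close>
    then show "barycentre \<mu> (translate \<gamma> z) = barycentre \<mu> z"
      using translate[OF z, of \<gamma>] barycentre_coboundary[OF rep cs ct contr, of v] by simp
  next
    fix z assume inv: "\<forall>z\<in>Z1 \<pi>. \<forall>\<gamma>. barycentre \<mu> (translate \<gamma> z) = barycentre \<mu> z" and z: "z \<in> Z1 \<pi>"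
    \<comment> \<open>Solving the invariance equation for \<open>z \<gamma>\<close> exhibits the
      barycentre as a vector whose coboundary is \<open>z\<close>.\<close>
    have "z \<gamma> = barycentre \<mu> z - \<pi> \<gamma> (barycentre \<mu> z)" for \<gamma>
      using inv z translate[OF z, of \<gamma>] by (simp add: algebra_simps)
    then show "z \<in> B1 \<pi>" unfolding B1_def by blast
  qed
qed

end
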